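(* Let $w\in\mathbb{C}$ with $\operatorname{Re}(w)>-1$ and let $z\in\mathbb{C}$. Then $$\int_{-\infty}^{\infty}\binom{w}{x}\,\mathrm{sinc}(x-z)\,dx=\binom{w}{z}.$$
   Context: For $w\in\mathbb{C}$ not a negative integer and $z\in\mathbb{C}$, the generalized binomial coefficient is $\binom{w}{z}=\frac{\Gamma(w+1)}{\Gamma(z+1)\Gamma(w-z+1)}$, where the reciprocal gamma function $1/\Gamma$ is understood as an entire function (equal to $0$ at the nonpositive integers). The function $\mathrm{sinc}:\mathbb{C}\to\mathbb{C}$ is defined by $\mathrm{sinc}(0)=1$ and $\mathrm{sinc}(z)=\frac{\sin(\pi z)}{\pi z}$ for $z\neq 0$. *)

theory Defs
  imports "HOL-Analysis.Analysis"
begin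

text \<open>
  The constant \<^const>\<open>rGamma\<close> is the entire reciprocal gamma function, which vanishes at the
  nonpositive integers. The definition is meaningful only for \<open>w\<close> not a negative integer; at the
  other points \<open>Gamma (w + 1)\<close> takes the library's default value 0.
\<close>

definition cbinomial :: "complex \<Rightarrow> complex \<Rightarrow> complex" where
  "cbinomial w z = Gamma (w + 1) * rGamma (z + 1) * rGamma (w - z + 1)"

definition csinc :: "complex \<Rightarrow> complex" where
  "csinc z = (if z = 0 then 1 else sin (of_real pi * z) / (of_real pi * z))"

end

theory Submission
  imports Defs "HOL-Probability.Sinc_Integral"
begin

text \<open>
  The function \<open>cbinomial w\<close> is the sum of its cardinal series,
  \<open>cbinomial w z = (\<Sum>n. (w gchoose n) * csinc (z - n))\<close>; after the reflection formula this is Gauss's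
  evaluation of the hypergeometric series with parameters \<open>- w\<close>, \<open>- z\<close>, \<open>1 - z\<close> at 1. Integrating the
  series against \<open>csinc (x - z)\<close> term by term and using
  \<open>\<integral> csinc (x - n) * csinc (x - z) dx = csinc (z - n)\<close> gives the cardinal series at \<open>z\<close>. The interchange
  is absolute: \<open>w gchoose n\<close> is at most of order \<open>n powr (- Re w - 1)\<close>, and the integrals of the absolute
  values of the kernels are at most of order \<open>n powr (s - 1)\<close> for every \<open>s > 0\<close>.
\<close>

section \<open>Gauss's summation theorem\<close>

text \<open>The argument of the hypergeometric series is fixed at 1, so no power of a variable
  occurs.\<close>

definition hyp2F1_term :: "complex \<Rightarrow> complex \<Rightarrow> complex \<Rightarrow> nat \<Rightarrow> complex" where
  "hyp2F1_term a b c n = pochhammer a n * pochhammer b n / (pochhammer c n * fact n)"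

lemma Re_pos_not_nonpos_Ints: "Re z > 0 \<Longrightarrow> z \<notin> \<int>\<^sub>\<le>\<^sub>0"
  by (auto elim!: nonpos_Ints_cases)

lemma pochhammer_Suc_eq_rGamma_series:
  "pochhammer z (Suc n) = rGamma_series z n * (fact n * exp (z * of_real (ln (real n))))" for z :: complex
  by (simp add: rGamma_series_def)

text \<open>Each Pochhammer symbol of length \<open>Suc n\<close> is \<open>rGamma_series\<close> at
  \<open>n\<close> times \<open>fact n\<close> times a power of \<open>n\<close>. The quotient
  \<open>Q\<close> of the series parts converges because \<open>rGamma c\<close> is nonzero, hence
  is bounded; the remaining factors leave the power of \<open>n\<close> over
  \<open>Suc n\<close>.\<close>

lemma hyp2F1_term_Suc_bound:
  fixes a b c :: complex
  assumes c: "c \<notin> \<int>\<^sub>\<le>\<^sub>0"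
  obtains K where "K > 0"
    "\<And>n. n \<ge> 1 \<Longrightarrow> norm (hyp2F1_term a b c (Suc n)) * real (Suc n) \<le> K * real n powr Re (a + b - c)"
proof -
  define Q where "Q = (\<lambda>n. rGamma_series a n * rGamma_series b n / rGamma_series c n)"
  have "Q \<longlonglongrightarrow> rGamma a * rGamma b / rGamma c"
    unfolding Q_def using c by (intro tendsto_intros) (auto simp: rGamma_eq_zero_iff)
  then have "Bseq Q"
    by (intro convergent_imp_Bseq convergentI)
  then obtain K where K: "K > 0" "\<And>n. norm (Q n) \<le> K"
    by (auto simp: Bseq_def)
  show ?thesis
  proof (rule that[OF K(1)])
    fix n :: nat assume n: "n \<ge> 1"
    have "hyp2F1_term a b c (Suc n) * of_nat (Suc n) = Q n * exp ((a + b - c) * of_real (ln (real n)))"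
      unfolding hyp2F1_term_def pochhammer_Suc_eq_rGamma_series Q_def
      by (simp add: exp_add exp_diff ring_distribs left_diff_distrib divide_simps del: of_nat_Suc)
    then have "norm (hyp2F1_term a b c (Suc n)) * real (Suc n) = norm (Q n) * real n powr Re (a + b - c)"
    proof -
      have "norm (exp ((a + b - c) * of_real (ln (real n)))) = real n powr Re (a + b - c)"
        using n by (simp add: powr_def)
      then show ?thesis
        by (metis \<open>_ = Q n * _\<close> norm_mult norm_of_nat)
    qed
    also have "\<dots> \<le> K * real n powr Re (a + b - c)"
      using K by (intro mult_right_mono) auto
    finally show "norm (hyp2F1_term a b c (Suc n)) * real (Suc n) \<le> K * real n powr Re (a + b - c)" .
  qed
qed

text \<open>The growth bound gives order \<open>n powr (Re (a + b - c) - 1)\<close>, whose exponent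
  is below -1. The second claim is the vanishing boundary term of the telescoping sum for the
  contiguous relation.\<close>

lemma
  fixes a b c :: complex
  assumes c: "c \<notin> \<int>\<^sub>\<le>\<^sub>0" and re: "Re (c - a - b) > 0"
  shows summable_norm_hyp2F1_term: "summable (\<lambda>n. norm (hyp2F1_term a b c n))"
    and tendsto_mult_hyp2F1_term: "(\<lambda>n. of_nat n * hyp2F1_term a b c n) \<longlonglongrightarrow> 0"
proof -
  obtain K where K: "K > 0"
    "\<And>n. n \<ge> 1 \<Longrightarrow> norm (hyp2F1_term a b c (Suc n)) * real (Suc n) \<le> K * real n powr Re (a + b - c)"
    using hyp2F1_term_Suc_bound[OF c] by metis
  have "summable (\<lambda>n. K * real n powr (Re (a + b - c) - 1))"
    using re by (intro summable_mult) (simp add: summable_real_powr_iff)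
  moreover have "norm (norm (hyp2F1_term a b c (Suc n))) \<le> K * real n powr (Re (a + b - c) - 1)" if "n \<ge> 1" for n
  proof -
    have "norm (hyp2F1_term a b c (Suc n)) * real n \<le> norm (hyp2F1_term a b c (Suc n)) * real (Suc n)"
      by (intro mult_left_mono) auto
    also note K(2)[OF that]
    finally show ?thesis
      using that by (subst powr_diff) (simp add: field_simps)
  qed
  ultimately have "summable (\<lambda>n. norm (hyp2F1_term a b c (Suc n)))"
    by (rule summable_comparison_test'[of _ 1])
  then show "summable (\<lambda>n. norm (hyp2F1_term a b c n))"
    by (subst (asm) summable_Suc_iff)
  have "(\<lambda>n. K * real n powr Re (a + b - c)) \<longlonglongrightarrow> K * 0"
    using re by (intro tendsto_intros tendsto_neg_powr filterlim_real_sequentially) auto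
  then have "(\<lambda>n. of_nat (Suc n) * hyp2F1_term a b c (Suc n)) \<longlonglongrightarrow> 0"
    unfolding mult_zero_right
    by (rule Lim_null_comparison[rotated])
       (use K(2) in \<open>auto simp: eventually_at_top_linorder norm_mult mult.commute simp del: of_nat_Suc intro!: exI[of _ 1]\<close>)
  then show "(\<lambda>n. of_nat n * hyp2F1_term a b c n) \<longlonglongrightarrow> 0"
    by (subst (asm) filterlim_sequentially_Suc)
qed

text \<open>
  The termwise difference of both sides telescopes: it is the forward difference of
  \<open>- c * n * hyp2F1_term a b c n\<close>.
\<close>

lemma hyp2F1_1_contiguous:
  fixes a b c :: complex
  assumes c: "c \<notin> \<int>\<^sub>\<le>\<^sub>0" and re: "Re (c - a - b) > 0"
  shows "c * (c - a - b) * (\<Sum>n. hyp2F1_term a b c n) =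
         (c - a) * (c - b) * (\<Sum>n. hyp2F1_term a b (c + 1) n)"
proof -
  let ?t = "hyp2F1_term a b c" and ?t' = "hyp2F1_term a b (c + 1)"
  have c1: "c + 1 \<notin> \<int>\<^sub>\<le>\<^sub>0"
    using c by (metis add_diff_cancel_right' nonpos_Ints_diff_Nats Nats_1)
  have c0: "c + of_nat n \<noteq> 0" for n
    using c by (metis eq_neg_iff_add_eq_0 minus_of_nat_in_nonpos_Ints)
  have poch: "pochhammer c n \<noteq> 0" for n
    using c0 by (auto simp: pochhammer_eq_0_iff eq_neg_iff_add_eq_0)
  have step: "c * (c - a - b) * ?t n - (c - a) * (c - b) * ?t' n =
      - (c * (of_nat (Suc n) * ?t (Suc n))) - - (c * (of_nat n * ?t n))" for n
  proof -
    have "c * pochhammer (c + 1) n = pochhammer c n * (c + of_nat n)"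
      by (metis pochhammer_Suc pochhammer_rec)
    then have p: "pochhammer (c + 1) n = pochhammer c n * (c + of_nat n) / c"
      using c0[of 0] by (simp add: field_simps)
    \<comment> \<open>With \<open>U\<close> factored out, all terms become polynomials in
      \<open>n\<close>, \<open>a\<close>, \<open>b\<close>, \<open>c\<close>, and
      \<open>step\<close> is a polynomial identity.\<close>
    define U where "U = ?t n / (c + of_nat n)"
    have "?t n = U * (c + of_nat n)"
      using c0[of n] by (simp add: U_def)
    moreover have "?t' n = U * c"
      unfolding U_def hyp2F1_term_def p using c0[of 0] by simp
    moreover have "of_nat (Suc n) * ?t (Suc n) = U * ((a + of_nat n) * (b + of_nat n))"
      by (simp add: U_def hyp2F1_term_def pochhammer_Suc mult_ac del: of_nat_Suc)
    ultimately show ?thesis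
      by (simp add: algebra_simps del: of_nat_Suc)
  qed
  have "(\<lambda>n. - (c * (of_nat n * ?t n))) \<longlonglongrightarrow> - (c * 0)"
    by (intro tendsto_intros tendsto_mult_hyp2F1_term c re)
  from telescope_sums[OF this] have "(\<lambda>n. c * (c - a - b) * ?t n - (c - a) * (c - b) * ?t' n) sums 0"
    by (simp add: step del: of_nat_Suc)
  moreover have "summable ?t" "summable ?t'"
    using c c1 re by (auto intro!: summable_norm_cancel[OF summable_norm_hyp2F1_term])
  then have "(\<lambda>n. c * (c - a - b) * ?t n - (c - a) * (c - b) * ?t' n) sums
      (c * (c - a - b) * suminf ?t - (c - a) * (c - b) * suminf ?t')"
    by (intro sums_diff sums_mult summable_sums)
  ultimately have "0 = c * (c - a - b) * suminf ?t - (c - a) * (c - b) * suminf ?t'"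
    by (rule sums_unique2)
  then show ?thesis
    by simp
qed

text \<open>Iterates the contiguous relation: each step raises \<open>c\<close> by 1 and adds one
  factor to every Pochhammer symbol.\<close>

lemma hyp2F1_1_shift:
  fixes a b c :: complex
  assumes c: "c \<notin> \<int>\<^sub>\<le>\<^sub>0" and re: "Re (c - a - b) > 0"
  shows "pochhammer c M * pochhammer (c - a - b) M * (\<Sum>n. hyp2F1_term a b c n) =
         pochhammer (c - a) M * pochhammer (c - b) M * (\<Sum>n. hyp2F1_term a b (c + of_nat M) n)"
proof (induction M)
  case (Suc M)
  have "c + of_nat M \<notin> \<int>\<^sub>\<le>\<^sub>0"
    using c by (metis add_diff_cancel_right' nonpos_Ints_diff_Nats of_nat_in_Nats)
  from hyp2F1_1_contiguous[OF this, of a b] re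
  have "(c + of_nat M) * (c + of_nat M - a - b) * (\<Sum>n. hyp2F1_term a b (c + of_nat M) n) =
      (c + of_nat M - a) * (c + of_nat M - b) * (\<Sum>n. hyp2F1_term a b (c + of_nat (Suc M)) n)"
    by (simp add: add_ac)
  with Suc show ?case
    unfolding pochhammer_Suc by (simp only: diff_add_eq[symmetric]) algebra
qed auto

text \<open>Every term with positive index tends to 0 as the lower parameter moves to the right, and
  the term of index 0 is 1. Tannery's theorem carries this over to the sum.\<close>

lemma hyp2F1_1_at_infinity:
  fixes a b c :: complex
  assumes re: "Re (c - a - b) > 0"
  shows "(\<lambda>M. \<Sum>n. hyp2F1_term a b (c + of_nat M) n) \<longlonglongrightarrow> 1"
proof -
  \<comment> \<open>From \<open>m\<close> on the real part is positive, so a further shift only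
    enlarges the modulus of each factor in the denominator. The series at
    \<open>c + of_nat m\<close> therefore dominates all later ones.\<close>
  define m where "m = nat \<lceil>\<bar>Re c\<bar> + 1\<rceil>"
  have m: "Re (c + of_nat m) > 0"
    unfolding m_def by simp linarith
  then have cm: "c + of_nat m \<notin> \<int>\<^sub>\<le>\<^sub>0"
    by (rule Re_pos_not_nonpos_Ints)
  have mono: "norm (pochhammer (c + of_nat m) n) \<le> norm (pochhammer (c + of_nat M) n)" if "M \<ge> m" for M n
    unfolding pochhammer_prod prod_norm[symmetric]
  proof (intro prod_mono conjI norm_ge_zero)
    fix i
    show "norm (c + of_nat m + of_nat i) \<le> norm (c + of_nat M + of_nat i)"
      using m that by (auto simp: cmod_def intro!: power_mono)
  qed
  have lim: "(\<lambda>M. hyp2F1_term a b (c + of_nat M) n) \<longlonglongrightarrow> (if n = 0 then 1 else 0)" for n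
  proof -
    have "(\<lambda>M. inverse (c + of_nat i + of_nat M)) \<longlonglongrightarrow> 0" for i :: nat
      by (intro filterlim_compose[OF tendsto_inverse_0] tendsto_add_filterlim_at_infinity[OF tendsto_const]
          tendsto_of_nat)
    then have "(\<lambda>M. pochhammer a n * pochhammer b n / fact n * (\<Prod>i = 0..<n. inverse (c + of_nat i + of_nat M)))
        \<longlonglongrightarrow> pochhammer a n * pochhammer b n / fact n * (\<Prod>i = 0..<n. 0)"
      by (intro tendsto_intros)
    moreover have "pochhammer a n * pochhammer b n / fact n * (\<Prod>i = 0..<n. inverse (c + of_nat i + of_nat M)) =
        hyp2F1_term a b (c + of_nat M) n" for M
      by (simp add: hyp2F1_term_def pochhammer_prod[of "c + of_nat M"] prod_inversef[symmetric, unfolded o_def] divide_inverse add_ac mult_ac)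
    ultimately show ?thesis
      by (cases n) simp_all
  qed
  have "eventually (\<lambda>(n, M). norm (hyp2F1_term a b (c + of_nat M) n) \<le> norm (hyp2F1_term a b (c + of_nat m) n))
      (at_top \<times>\<^sub>F sequentially)"
  proof -
    have "pochhammer (c + of_nat m) n \<noteq> 0" for n
      using cm by (auto simp: pochhammer_eq_0_iff)
    then have "norm (hyp2F1_term a b (c + of_nat M) n) \<le> norm (hyp2F1_term a b (c + of_nat m) n)" if "M \<ge> m" for M n
      unfolding hyp2F1_term_def norm_divide norm_mult
      by (intro divide_left_mono mult_right_mono mono[OF that] mult_nonneg_nonneg mult_pos_pos)
         (use mono[OF that, of n] in \<open>auto simp: order_less_le_trans\<close>)
    then show ?thesis
      using eventually_prod2[of sequentially "\<lambda>M. M \<ge> m" at_top]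
      by (auto elim!: eventually_mono simp: eventually_ge_at_top)
  qed
  from tannerys_theorem[OF lim this]
  have "(\<lambda>M. \<Sum>n. hyp2F1_term a b (c + of_nat M) n) \<longlonglongrightarrow> (\<Sum>n. if n = 0 then 1 else 0)"
    using summable_norm_hyp2F1_term[OF cm, of a b] re by simp
  then show ?thesis
    using sums_unique[OF sums_single[of 0 "\<lambda>_. 1 :: complex"]] by simp
qed

text \<open>Normalising the Pochhammer symbols in the shift relation turns them into
  \<open>rGamma_series\<close>. The normalising factors agree on both sides because
  \<open>c + (c - a - b) = (c - a) + (c - b)\<close>, so letting the shift tend to infinity gives
  the value.\<close>

theorem Gauss_hyp2F1_1:
  fixes a b c :: complex
  assumes c: "c \<notin> \<int>\<^sub>\<le>\<^sub>0" and re: "Re (c - a - b) > 0"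
  shows "hyp2F1_term a b c sums (Gamma c * Gamma (c - a - b) * rGamma (c - a) * rGamma (c - b))"
proof -
  let ?F = "\<Sum>n. hyp2F1_term a b c n"
  have d: "c - a - b \<notin> \<int>\<^sub>\<le>\<^sub>0"
    using re by (rule Re_pos_not_nonpos_Ints)
  have "rGamma_series c M * rGamma_series (c - a - b) M * ?F =
      rGamma_series (c - a) M * rGamma_series (c - b) M * (\<Sum>n. hyp2F1_term a b (c + of_nat (Suc M)) n)" for M
    using hyp2F1_1_shift[OF c re, of "Suc M"]
    unfolding rGamma_series_def by (simp add: field_simps exp_add exp_diff ring_distribs left_diff_distrib)
  moreover have "(\<lambda>M. rGamma_series c M * rGamma_series (c - a - b) M * ?F) \<longlonglongrightarrow> rGamma c * rGamma (c - a - b) * ?F"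
    by (intro tendsto_intros)
  moreover have "(\<lambda>M. rGamma_series (c - a) M * rGamma_series (c - b) M * (\<Sum>n. hyp2F1_term a b (c + of_nat (Suc M)) n))
      \<longlonglongrightarrow> rGamma (c - a) * rGamma (c - b) * 1"
    by (intro tendsto_intros filterlim_sequentially_Suc[THEN iffD2, OF hyp2F1_1_at_infinity[OF re]])
  ultimately have main: "rGamma c * rGamma (c - a - b) * ?F = rGamma (c - a) * rGamma (c - b)"
    using LIMSEQ_unique by fastforce
  have "?F = Gamma c * Gamma (c - a - b) * (rGamma c * rGamma (c - a - b) * ?F)"
  proof -
    have "Gamma c * rGamma c = 1" "Gamma (c - a - b) * rGamma (c - a - b) = 1"
      using c d by (simp_all add: Gamma_def rGamma_eq_zero_iff)
    then show ?thesis
      by algebra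
  qed
  also have "\<dots> = Gamma c * Gamma (c - a - b) * (rGamma (c - a) * rGamma (c - b))"
    by (subst main) (rule refl)
  also have "\<dots> = Gamma c * Gamma (c - a - b) * rGamma (c - a) * rGamma (c - b)"
    by (rule mult.assoc[symmetric])
  finally have F: "?F = \<dots>" .
  show ?thesis
    unfolding F[symmetric] by (rule summable_sums[OF summable_norm_cancel[OF summable_norm_hyp2F1_term[OF c re]]])
qed

section \<open>The cardinal series of the binomial coefficient\<close>

text \<open>The reflection formula. This form has no case distinction at 0, which makes continuity
  immediate and lets Gamma factors cancel in the cardinal series.\<close>

lemma csinc_eq_rGamma: "csinc z = rGamma (z + 1) * rGamma (1 - z)"
proof (cases "z = 0")
  case False
  then show ?thesis
    using rGamma_reflection_complex[of z] rGamma_plus1[of z, symmetric]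
    by (simp add: csinc_def field_simps)
qed (simp add: csinc_def)

lemma csinc_of_nat_diff: "csinc (of_nat m - of_nat n) = (if n = m then 1 else 0)"
proof (cases "n = m")
  case False
  have "sin (of_real pi * (of_nat m - of_nat n)) = complex_of_real (sin (pi * (real m - real n)))"
    by (simp flip: sin_of_real)
  also have "sin (pi * (real m - real n)) = 0"
    by (simp add: right_diff_distrib sin_diff mult.commute[of pi])
  finally have "sin (of_real pi * (of_nat m - of_nat n)) = (0 :: complex)"
    by simp
  with False show ?thesis
    unfolding csinc_def by (simp only: div_0) simp
qed (simp add: csinc_def)

text \<open>Isolates the factor \<open>z / (z - of_nat n)\<close>, which is also the quotient of the
  Pochhammer symbols of \<open>- z\<close> and \<open>1 - z\<close>.\<close>

lemma csinc_diff_of_nat: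
  assumes "z \<noteq> of_nat n" "z \<noteq> 0"
  shows "csinc (z - of_nat n) = (- 1) ^ n * csinc z * z / (z - of_nat n)"
proof -
  have "sin (of_real pi * of_nat n) = (0 :: complex)" "cos (of_real pi * of_nat n) = ((- 1) ^ n :: complex)"
    using sin_of_real[of "pi * real n", where ?'a = complex] cos_of_real[of "pi * real n", where ?'a = complex]
    by simp_all
  then have "sin (of_real pi * (z - of_nat n)) = sin (of_real pi * z) * (- 1) ^ n"
    by (simp add: right_diff_distrib sin_diff)
  then show ?thesis
    using assms by (simp add: csinc_def)
qed

lemma cbinomial_of_nat:
  assumes "w + 1 \<notin> \<int>\<^sub>\<le>\<^sub>0"
  shows "cbinomial w (of_nat m) = w gchoose m"
  using gbinomial_Gamma[OF assms, of m] Gamma_fact[of m, where ?'a = complex]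
  by (simp add: cbinomial_def rGamma_inverse_Gamma divide_inverse add.commute)

theorem cbinomial_cardinal_series:
  assumes w: "Re w > -1"
  shows "(\<lambda>n. (w gchoose n) * csinc (z - of_nat n)) sums cbinomial w z"
proof (cases "z \<in> \<nat>")
  \<comment> \<open>At a natural number the series collapses to a single term. Gauss's theorem is
    reserved for the other case, where \<open>1 - z\<close> is not a nonpositive integer.\<close>
  case True
  then obtain m where m: "z = of_nat m"
    by (elim Nats_cases)
  have "w + 1 \<notin> \<int>\<^sub>\<le>\<^sub>0"
    using w by (intro Re_pos_not_nonpos_Ints) simp
  then show ?thesis
    using sums_single[of m "\<lambda>n. w gchoose n"]
    by (simp add: m csinc_of_nat_diff cbinomial_of_nat if_distrib cong: if_cong)
next
  case False
  have z: "1 - z \<notin> \<int>\<^sub>\<le>\<^sub>0"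
  proof
    assume "1 - z \<in> \<int>\<^sub>\<le>\<^sub>0"
    then obtain k where "1 - z = - of_nat k"
      by (elim nonpos_Ints_cases')
    then have "z = of_nat (Suc k)"
      by (simp add: algebra_simps)
    with False show False
      by (metis of_nat_in_Nats)
  qed
  have nz: "z \<noteq> of_nat n" for n
    using False by auto
  have "csinc z * hyp2F1_term (- w) (- z) (1 - z) n = (w gchoose n) * csinc (z - of_nat n)" for n
  proof -
    have "- z * pochhammer (1 - z) n = pochhammer (- z) n * (of_nat n - z)"
      using pochhammer_rec[of "- z" n] pochhammer_Suc[of "- z" n] by (simp add: add_ac)
    then have "pochhammer (- z) n = z / (z - of_nat n) * pochhammer (1 - z) n"
      using nz[of n] by (simp add: field_simps)
    moreover have "pochhammer (1 - z) n \<noteq> 0"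
      using z by (auto simp: pochhammer_eq_0_iff)
    ultimately have "hyp2F1_term (- w) (- z) (1 - z) n = pochhammer (- w) n / fact n * (z / (z - of_nat n))"
      by (simp add: hyp2F1_term_def)
    then show ?thesis
      using nz[of n] nz[of 0] by (simp add: gbinomial_pochhammer csinc_diff_of_nat)
  qed
  \<comment> \<open>Here \<open>c - a - b\<close> equals \<open>w + 1\<close>, so the convergence
    condition is exactly \<open>Re w > -1\<close>.\<close>
  moreover have "(\<lambda>n. csinc z * hyp2F1_term (- w) (- z) (1 - z) n) sums
      (csinc z * (Gamma (1 - z) * Gamma (1 - z - - w - - z) * rGamma (1 - z - - w) * rGamma (1 - z - - z)))"
    using w by (intro sums_mult Gauss_hyp2F1_1 z) simp
  \<comment> \<open>\<open>Gamma (1 - z)\<close> cancels one reciprocal Gamma factor of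
    \<open>csinc z\<close>; the other one, \<open>rGamma (z + 1)\<close>, belongs to the binomial
    coefficient.\<close>
  moreover have "rGamma (1 - z) * Gamma (1 - z) = 1"
    using z by (simp add: rGamma_inverse_Gamma Gamma_eq_zero_iff)
  then have "csinc z * (Gamma (1 - z) * Gamma (1 - z - - w - - z) * rGamma (1 - z - - w) * rGamma (1 - z - - z)) =
      cbinomial w z"
    by (simp add: csinc_eq_rGamma cbinomial_def algebra_simps)
  ultimately show ?thesis
    by simp
qed

text \<open>Up to sign the coefficients are hypergeometric terms with \<open>b = c = 1\<close>, so
  the general growth bound applies.\<close>

lemma gbinomial_Suc_bound:
  fixes w :: complex
  obtains K where "K > 0" "\<And>n. n \<ge> 1 \<Longrightarrow> norm (w gchoose Suc n) * real (Suc n) \<le> K * real n powr (- Re w)"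
proof -
  have "norm (hyp2F1_term (- w) 1 1 n) = norm (w gchoose n)" for n
    by (simp add: hyp2F1_term_def gbinomial_pochhammer norm_mult norm_divide norm_power pochhammer_fact[symmetric])
  moreover obtain K where "K > 0" "\<And>n. n \<ge> 1 \<Longrightarrow>
      norm (hyp2F1_term (- w) 1 1 (Suc n)) * real (Suc n) \<le> K * real n powr Re (- w + 1 - 1)"
    by (rule hyp2F1_term_Suc_bound[of 1 "- w" 1]) auto
  ultimately show ?thesis
    using that[of K] by (simp del: of_nat_Suc)
qed

section \<open>Orthogonality of shifted sinc functions\<close>

lemma continuous_on_csinc [continuous_intros]:
  "continuous_on A f \<Longrightarrow> continuous_on A (\<lambda>x. csinc (f x))"
  unfolding csinc_eq_rGamma
  by (intro continuous_intros continuous_on_compose2[OF continuous_on_rGamma[of UNIV]]) auto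

lemma csinc_of_real: "csinc (of_real x) = of_real (if x = 0 then 1 else sin (pi * x) / (pi * x))"
  using sin_of_real[of "pi * x", where ?'a = complex] by (simp add: csinc_def)

lemma csinc_minus [simp]: "csinc (- z) = csinc z"
  by (simp add: csinc_def)

text \<open>The band-limited form of sinc, its Fourier integral over [-1, 1] folded by evenness. It
  serves both to evaluate the product integrals and to bound \<open>csinc\<close>.\<close>

lemma has_integral_cos_csinc: "((\<lambda>u. cos (of_real (pi * u) * z)) has_integral csinc z) {0..1}"
proof (cases "z = 0")
  case True
  then show ?thesis
    using has_integral_const_real[of "1 :: complex" 0 1] by (simp add: csinc_def)
next
  case False
  have "((\<lambda>u. cos (of_real (pi * u) * z)) has_integral
      sin (of_real (pi * 1) * z) / (of_real pi * z) - sin (of_real (pi * 0) * z) / (of_real pi * z)) {0..1}"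
  proof (rule fundamental_theorem_of_calculus)
    fix u :: real
    have "((\<lambda>u. sin (u * (of_real pi * z)) / (of_real pi * z)) has_field_derivative
        cos (of_real u * (of_real pi * z))) (at (of_real u))"
      using False by (auto intro!: derivative_eq_intros)
    from has_vector_derivative_real_field[OF this]
    show "((\<lambda>u. sin (of_real (pi * u) * z) / (of_real pi * z)) has_vector_derivative
        cos (of_real (pi * u) * z)) (at u within {0..1})"
      by (simp add: mult_ac has_vector_derivative_at_within)
  qed simp
  with False show ?thesis
    by (simp add: csinc_def)
qed

lemma integral_odd:
  fixes f :: "real \<Rightarrow> 'a :: euclidean_space"
  assumes "\<And>x. f (- x) = - f x"
  shows "integral {- R..R} f = 0"
proof -
  have "integral {- R..R} f = integral {- R..R} (\<lambda>x. f (- x))"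
    using Henstock_Kurzweil_Integration.integral_reflect_real[of R "- R" f] by simp
  also have "\<dots> = - integral {- R..R} f"
    by (simp add: assms)
  finally have "2 *\<^sub>R integral {- R..R} f = 0"
    unfolding scaleR_2 by (metis add.right_inverse)
  then show ?thesis
    by simp
qed

lemma Si_0: "Si 0 = 0"
  using Si_neg[of 0] by simp

text \<open>The product-to-sum formula splits the integrand into sines of frequencies
  \<open>pi * (1 + u)\<close> and \<open>pi * (1 - u)\<close> over \<open>x\<close>, whose
  primitives are given by \<open>Si\<close>.\<close>

lemma has_integral_sinc_cos:
  fixes R u :: real
  assumes R: "R \<ge> 0" and u: "0 \<le> u" "u \<le> 1"
  shows "((\<lambda>x. csinc (of_real x) * of_real (cos (pi * u * x))) has_integral
           of_real ((Si (pi * (1 + u) * R) + Si (pi * (1 - u) * R)) / pi)) {- R..R}"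
proof -
  define G where "G x = (Si (pi * (1 + u) * x) + Si (pi * (1 - u) * x)) / (2 * pi)" for x
  have "((\<lambda>x. sinc (pi * x) * cos (pi * u * x)) has_integral (G R - G (- R))) {- R..R}"
  proof (rule fundamental_theorem_of_calculus)
    fix x
    have chain: "((\<lambda>x. Si (c * x)) has_real_derivative sinc (c * x) * c) (at x)" for c
      using DERIV_chain2[OF DERIV_Si, of "\<lambda>x. c * x" c] by (auto intro!: derivative_eq_intros)
    have "(G has_real_derivative
        (sinc (pi * (1 + u) * x) * (pi * (1 + u)) + sinc (pi * (1 - u) * x) * (pi * (1 - u))) / (2 * pi)) (at x)"
      unfolding G_def[abs_def] by (intro DERIV_cdivide DERIV_add chain)
    also have "(sinc (pi * (1 + u) * x) * (pi * (1 + u)) + sinc (pi * (1 - u) * x) * (pi * (1 - u))) / (2 * pi) =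
        sinc (pi * x) * cos (pi * u * x)"
    proof (cases "x = 0")
      case True
      then show ?thesis
        by (simp add: field_simps)
    next
      case False
      have s: "sinc (pi * c * x) * (pi * c) = sin (pi * c * x) / x" for c
        using False by simp
      have "sin (pi * (1 + u) * x) + sin (pi * (1 - u) * x) = 2 * (sin (pi * x) * cos (pi * u * x))"
        by (simp add: ring_distribs left_diff_distrib sin_add sin_diff)
      then show ?thesis
        unfolding s using False by (simp add: field_simps)
    qed
    finally show "(G has_vector_derivative sinc (pi * x) * cos (pi * u * x)) (at x within {- R..R})"
      by (simp add: has_real_derivative_iff_has_vector_derivative has_vector_derivative_at_within)
  qed (use R in simp)
  moreover have "G R - G (- R) = (Si (pi * (1 + u) * R) + Si (pi * (1 - u) * R)) / pi"
  proof -
    \<comment> \<open>\<open>Si_neg\<close> is stated for nonnegative arguments; the signs of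
      \<open>R\<close>, \<open>1 + u\<close> and \<open>1 - u\<close> supply this.\<close>
    have "Si (pi * (1 + u) * - R) = - Si (pi * (1 + u) * R)" "Si (pi * (1 - u) * - R) = - Si (pi * (1 - u) * R)"
      unfolding mult_minus_right using R u by (auto intro!: Si_neg)
    then show ?thesis
      unfolding G_def by (simp only:) (simp add: divide_simps)
  qed
  ultimately have "((\<lambda>x. complex_of_real (sinc (pi * x) * cos (pi * u * x))) has_integral
      of_real ((Si (pi * (1 + u) * R) + Si (pi * (1 - u) * R)) / pi)) {- R..R}"
    by (simp only: has_integral_of_real)
  moreover have "complex_of_real (sinc (pi * x) * cos (pi * u * x)) =
      csinc (of_real x) * of_real (cos (pi * u * x))" for x
    by (simp add: csinc_of_real)
  ultimately show ?thesis
    by (simp only:)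
qed

text \<open>By the addition formula the integrand is a combination of an even and an odd function of
  \<open>x\<close>; the odd one integrates to 0 over the symmetric interval.\<close>

lemma integral_csinc_cos:
  assumes R: "R \<ge> 0" and u: "0 \<le> u" "u \<le> 1"
  shows "integral {- R..R} (\<lambda>x. csinc (of_real x) * cos (of_real (pi * u) * (of_real x - z))) =
           cos (of_real (pi * u) * z) * of_real ((Si (pi * (1 + u) * R) + Si (pi * (1 - u) * R)) / pi)"
proof -
  let ?c = "\<lambda>x. csinc (of_real x) * of_real (cos (pi * u * x))"
  let ?s = "\<lambda>x. csinc (of_real x) * of_real (sin (pi * u * x))"
  have "csinc (of_real x) * cos (of_real (pi * u) * (of_real x - z)) =
      cos (of_real (pi * u) * z) * ?c x + sin (of_real (pi * u) * z) * ?s x" for x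
  proof -
    have "cos (of_real (pi * u) * (of_real x - z)) =
        cos (of_real (pi * u * x)) * cos (of_real (pi * u) * z) + sin (of_real (pi * u * x)) * sin (of_real (pi * u) * z)"
      unfolding right_diff_distrib cos_diff of_real_mult ..
    then show ?thesis
      by (simp only: cos_of_real sin_of_real) (simp add: algebra_simps)
  qed
  moreover have "(?c has_integral of_real ((Si (pi * (1 + u) * R) + Si (pi * (1 - u) * R)) / pi)) {- R..R}"
    by (rule has_integral_sinc_cos[OF assms])
  moreover have "(?s has_integral 0) {- R..R}"
  proof -
    have "?s integrable_on {- R..R}"
      by (intro integrable_continuous_real continuous_intros)
    moreover have "integral {- R..R} ?s = 0"
      by (rule integral_odd) simp
    ultimately show ?thesis
      by (metis integrable_integral)
  qed
  ultimately have "((\<lambda>x. csinc (of_real x) * cos (of_real (pi * u) * (of_real x - z))) has_integral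
      (cos (of_real (pi * u) * z) * of_real ((Si (pi * (1 + u) * R) + Si (pi * (1 - u) * R)) / pi) +
       sin (of_real (pi * u) * z) * 0)) {- R..R}"
    by (simp only:) (intro has_integral_add has_integral_mult_right)
  then show ?thesis
    by (simp add: integral_unique)
qed

text \<open>
  Writing the second factor as a cosine integral and swapping the integrals leaves a Dirichlet
  integral, which is bounded uniformly in the frequency \<open>u\<close> and tends to 1 for \<open>u < 1\<close>.
\<close>

lemma tendsto_integral_csinc_csinc:
  "(\<lambda>n. integral {- real n..real n} (\<lambda>x. csinc (of_real x) * csinc (of_real x - z))) \<longlonglongrightarrow> csinc z"
proof -
  define S where "S n u = (Si (pi * (1 + u) * real n) + Si (pi * (1 - u) * real n)) / pi" for n u
  have swap: "integral {- real n..real n} (\<lambda>x. csinc (of_real x) * csinc (of_real x - z)) =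
      integral {0..1} (\<lambda>u. cos (of_real (pi * u) * z) * of_real (S n u))" for n
  proof -
    have "integral {- real n..real n} (\<lambda>x. csinc (of_real x) * csinc (of_real x - z)) =
        integral {- real n..real n} (\<lambda>x. integral {0..1} (\<lambda>u. csinc (of_real x) * cos (of_real (pi * u) * (of_real x - z))))"
      by (intro integral_cong sym[OF integral_unique] has_integral_mult_right has_integral_cos_csinc)
    also have "\<dots> = integral {0..1} (\<lambda>u. integral {- real n..real n} (\<lambda>x. csinc (of_real x) * cos (of_real (pi * u) * (of_real x - z))))"
      unfolding cbox_interval[symmetric]
      by (rule integral_swap_continuous) (auto simp: case_prod_unfold intro!: continuous_intros)
    also have "\<dots> = integral {0..1} (\<lambda>u. cos (of_real (pi * u) * z) * of_real (S n u))"
      unfolding S_def by (intro integral_cong integral_csinc_cos) auto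
    finally show ?thesis .
  qed
  obtain B where B: "\<And>T. \<bar>Si T\<bar> \<le> B"
    using bounded_Si by blast
  \<comment> \<open>At \<open>u = 1\<close> the second frequency vanishes and
    \<open>Si 0 = 0\<close> leaves half the limit. The exceptional point is a null set, removed
    below by \<open>integral_spike\<close>.\<close>
  define g where "g u = cos (of_real (pi * u) * z) * (if u = 1 then of_real (1 / 2) else 1)" for u :: real
  have "(\<lambda>n. integral {0..1} (\<lambda>u. cos (of_real (pi * u) * z) * of_real (S n u))) \<longlonglongrightarrow> integral {0..1} g"
  proof (rule dominated_convergence)
    fix n
    show "(\<lambda>u. cos (of_real (pi * u) * z) * of_real (S n u)) integrable_on {0..1}"
      unfolding S_def
      by (intro integrable_continuous_real continuous_intros continuous_on_compose2[OF continuous_at_imp_continuous_on[of UNIV Si]])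
         (auto simp: isCont_Si)
    show "(\<lambda>u. norm (cos (of_real (pi * u) * z)) * (2 * B / pi)) integrable_on {0..1}"
      by (intro integrable_continuous_real continuous_intros)
    fix u :: real
    have "\<bar>S n u\<bar> \<le> 2 * B / pi"
      using B[of "pi * (1 + u) * real n"] B[of "pi * (1 - u) * real n"]
      by (auto simp: S_def abs_divide intro!: divide_right_mono)
    then show "norm (cos (of_real (pi * u) * z) * of_real (S n u)) \<le> norm (cos (of_real (pi * u) * z)) * (2 * B / pi)"
      unfolding norm_mult norm_of_real by (intro mult_left_mono) auto
  next
    fix u :: real
    assume u: "u \<in> {0..1}"
    have lim: "(\<lambda>n. Si (pi * c * real n)) \<longlonglongrightarrow> pi / 2" if "c > 0" for c
      using that by (intro filterlim_compose[OF Si_at_top]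
          filterlim_tendsto_pos_mult_at_top[OF tendsto_const] filterlim_real_sequentially) auto
    have "(\<lambda>n. S n u) \<longlonglongrightarrow> (if u = 1 then 1 / 2 else 1)"
    proof (cases "u = 1")
      case True
      have "(\<lambda>n. (Si (pi * 2 * real n) + Si 0) / pi) \<longlonglongrightarrow> (pi / 2 + Si 0) / pi"
        by (intro tendsto_intros lim) auto
      with True show ?thesis
        by (simp add: S_def Si_0 mult_ac)
    next
      case False
      have "(\<lambda>n. S n u) \<longlonglongrightarrow> (pi / 2 + pi / 2) / pi"
        unfolding S_def using False u by (intro tendsto_intros lim) auto
      with False show ?thesis
        by simp
    qed
    then have "(\<lambda>n. cos (of_real (pi * u) * z) * of_real (S n u)) \<longlonglongrightarrow>
        cos (of_real (pi * u) * z) * of_real (if u = 1 then 1 / 2 else 1)"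
      by (intro tendsto_intros)
    then show "(\<lambda>n. cos (of_real (pi * u) * z) * of_real (S n u)) \<longlonglongrightarrow> g u"
      by (simp add: g_def if_distrib cong: if_cong)
  qed
  also have "integral {0..1} g = integral {0..1} (\<lambda>u. cos (of_real (pi * u) * z))"
    by (rule integral_spike[of "{1}"]) (auto simp: g_def)
  also have "\<dots> = csinc z"
    by (rule integral_unique[OF has_integral_cos_csinc])
  finally show ?thesis
    unfolding swap .
qed

section \<open>Decay of sinc and absolute integrability of products\<close>

lemma norm_cos_le_exp_Im: "norm (cos z) \<le> exp \<bar>Im z\<bar>"
  and norm_sin_le_exp_Im: "norm (sin z) \<le> exp \<bar>Im z\<bar>"
proof -
  have *: "norm (exp (\<i> * z)) \<le> exp \<bar>Im z\<bar>" "norm (exp (- (\<i> * z))) \<le> exp \<bar>Im z\<bar>"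
    by (auto simp: norm_exp_eq_Re)
  have "norm (exp (\<i> * z) + exp (- (\<i> * z))) \<le> 2 * exp \<bar>Im z\<bar>"
    using norm_triangle_mono[OF *] by simp
  then show "norm (cos z) \<le> exp \<bar>Im z\<bar>"
    by (simp add: cos_exp_eq norm_divide)
  have "norm (exp (\<i> * z) - exp (- (\<i> * z))) \<le> 2 * exp \<bar>Im z\<bar>"
    unfolding mult_2 by (intro norm_triangle_le_diff add_mono *)
  then show "norm (sin z) \<le> exp \<bar>Im z\<bar>"
    by (simp add: sin_exp_eq norm_divide norm_mult)
qed

text \<open>Sum of two bounds: the cosine integral controls \<open>norm (csinc z)\<close>, and the
  defining quotient controls \<open>norm (csinc z) * norm z\<close>.\<close>

lemma norm_csinc_le: "norm (csinc z) * (1 + norm z) \<le> 2 * exp (pi * \<bar>Im z\<bar>)"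
proof -
  have "norm (csinc z) \<le> exp (pi * \<bar>Im z\<bar>) * measure lborel (cbox 0 (1 :: real))"
  proof (rule has_integral_bound)
    show "((\<lambda>u. cos (of_real (pi * u) * z)) has_integral csinc z) (cbox 0 1)"
      using has_integral_cos_csinc by simp
    fix u :: real assume u: "u \<in> cbox 0 1"
    have "norm (cos (of_real (pi * u) * z)) \<le> exp \<bar>pi * u * Im z\<bar>"
      using norm_cos_le_exp_Im[of "of_real (pi * u) * z"] by simp
    also have "\<dots> \<le> exp (pi * \<bar>Im z\<bar>)"
      using u by (simp add: abs_mult mult_left_le_one_le mult.assoc)
    finally show "norm (cos (of_real (pi * u) * z)) \<le> exp (pi * \<bar>Im z\<bar>)" .
  qed auto
  moreover have "norm (csinc z) * norm z \<le> exp (pi * \<bar>Im z\<bar>)"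
  proof (cases "z = 0")
    case False
    have "norm (csinc z) * norm z = norm (sin (of_real pi * z)) / pi"
      using False by (simp add: csinc_def norm_divide norm_mult)
    also have "\<dots> \<le> exp (pi * \<bar>Im z\<bar>) / 1"
      using norm_sin_le_exp_Im[of "of_real pi * z"] pi_ge_two by (intro frac_le) (auto simp: abs_mult)
    finally show ?thesis
      by simp
  qed auto
  ultimately show ?thesis
    by (simp add: ring_distribs)
qed

text \<open>Along the real line the imaginary part is constant, so the exponential is too. The
  triangle inequality moves the decay from \<open>z\<close> to the origin at the cost of the factor
  \<open>1 + norm z\<close>.\<close>

lemma norm_csinc_real_shift_le:
  "norm (csinc (of_real x - z)) \<le> 2 * (1 + norm z) * exp (pi * \<bar>Im z\<bar>) / (1 + \<bar>x\<bar>)"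
proof -
  have "norm (csinc (of_real x - z)) * (1 + norm (of_real x - z)) \<le> 2 * exp (pi * \<bar>Im z\<bar>)"
    using norm_csinc_le[of "of_real x - z"] by simp
  moreover have "1 + \<bar>x\<bar> \<le> (1 + norm (of_real x - z)) * (1 + norm z)"
  proof -
    have "\<bar>x\<bar> \<le> norm (of_real x - z) + norm z"
      using norm_triangle_ineq[of "of_real x - z" z] by simp
    moreover have "0 \<le> norm (of_real x - z) * norm z"
      by simp
    ultimately show ?thesis
      unfolding ring_distribs by linarith
  qed
  ultimately have "norm (csinc (of_real x - z)) * (1 + \<bar>x\<bar>) \<le> (2 * exp (pi * \<bar>Im z\<bar>)) * (1 + norm z)"
    by (smt (verit, ccfv_SIG) mult.assoc mult_left_mono mult_right_mono norm_ge_zero)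
  then show ?thesis
    by (simp add: field_simps)
qed

text \<open>The larger of \<open>a\<close> and \<open>b\<close> is at least \<open>N / 2\<close>.
  Its power \<open>s - 1\<close> gives the decay in \<open>N\<close>; its remaining power
  \<open>- s\<close> is replaced by that of the smaller one, which for positive \<open>s\<close>
  yields an integrable exponent below -1.\<close>

lemma powr_split_bound:
  fixes a b N s :: real
  assumes "a \<ge> 1" "b \<ge> 1" "N > 0" "N \<le> a + b" "0 \<le> s" "s \<le> 1"
  shows "1 / (a * b) \<le> (N / 2) powr (s - 1) * (a powr (- 1 - s) + b powr (- 1 - s))"
proof -
  have *: "1 / (a * b) \<le> (N / 2) powr (s - 1) * (a powr (- 1 - s))"
    if "1 \<le> a" "a \<le> b" "N \<le> a + b" for a b :: real
  proof -
    have "1 / (a * b) = b powr (s - 1) * (a powr (- 1) * b powr (- s))"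
      using that by (simp add: powr_minus powr_diff divide_simps)
    also have "\<dots> \<le> (N / 2) powr (s - 1) * (a powr (- 1) * a powr (- s))"
      using that assms by (intro mult_mono powr_mono2') auto
    also have "a powr (- 1) * a powr (- s) = a powr (- 1 - s)"
      unfolding powr_add[symmetric] by simp
    finally show ?thesis .
  qed
  have "0 \<le> (N / 2) powr (s - 1) * b powr (- 1 - s)" "0 \<le> (N / 2) powr (s - 1) * a powr (- 1 - s)"
    by auto
  then show ?thesis
    using *[of a b] *[of b a] assms unfolding ring_distribs mult.commute[of b a] by linarith
qed

text \<open>The function is dominated by the sum of a half-line power function moved to start at 0
  and its mirror image.\<close>

lemma integrable_one_plus_abs_powr:
  fixes p :: real
  assumes p: "p < - 1"
  shows "integrable lborel (\<lambda>x. (1 + \<bar>x\<bar>) powr p)"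
proof -
  let ?h = "\<lambda>x :: real. indicator {1..} x *\<^sub>R x powr p"
  have "(\<lambda>x. x powr p) absolutely_integrable_on {1..}"
    using has_integral_powr_to_inf[of p 1] p
    by (intro nonnegative_absolutely_integrable_1) (auto simp: has_integral_integrable)
  then have h: "integrable lborel ?h"
    unfolding absolutely_integrable_on_def set_integrable_def
    by (subst (asm) integrable_completion) auto
  have "integrable lborel (\<lambda>x. ?h (1 + 1 * x) + ?h (1 + (- 1) * x))"
    by (intro Bochner_Integration.integrable_add lborel_integrable_real_affine[OF h]) auto
  then show ?thesis
    by (rule Bochner_Integration.integrable_bound) (auto simp: indicator_def abs_if)
qed

text \<open>The factors decay away from \<open>real n\<close> and from 0. With
  \<open>a = 1 + \<bar>x - real n\<bar>\<close> and \<open>b = 1 + \<bar>x\<bar>\<close>, the sum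
  \<open>a + b\<close> is at least \<open>1 + real n\<close>, so the splitting bound gives an
  integrable majorant with the required decay in \<open>n\<close>.\<close>

lemma integral_csinc_product_bound:
  assumes s: "0 < s" "s \<le> 1"
  obtains C where "C \<ge> 0"
    "\<And>n. integrable lborel (\<lambda>x. csinc (of_real x - of_nat n) * csinc (of_real x - z))"
    "\<And>n. (\<integral>x. norm (csinc (of_real x - of_nat n) * csinc (of_real x - z)) \<partial>lborel) \<le> C * (1 + real n) powr (s - 1)"
proof -
  let ?q = "\<lambda>x :: real. (1 + \<bar>x\<bar>) powr (- 1 - s)"
  define Cz where "Cz = 2 * (1 + norm z) * exp (pi * \<bar>Im z\<bar>)"
  have Cz: "Cz \<ge> 0"
    by (simp add: Cz_def)
  have q: "integrable lborel ?q"
    using s by (intro integrable_one_plus_abs_powr) auto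
  have qn: "integrable lborel (\<lambda>x. ?q (x - real n))" "(\<integral>x. ?q (x - real n) \<partial>lborel) = (\<integral>x. ?q x \<partial>lborel)" for n
    using lborel_integrable_real_affine[OF q, of 1 "- real n"]
      lborel_integral_real_affine[of 1 ?q "- real n"] by (simp_all add: algebra_simps)
  define g where "g n x = 2 * Cz * ((1 + real n) / 2) powr (s - 1) * (?q (x - real n) + ?q x)" for n x
  have g: "integrable lborel (g n)" for n
    unfolding g_def using q qn by auto
  have bound: "norm (csinc (of_real x - of_nat n) * csinc (of_real x - z)) \<le> g n x" for n x
  proof -
    have "norm (csinc (of_real x - of_nat n)) \<le> 2 / (1 + \<bar>x - real n\<bar>)"
      using norm_csinc_real_shift_le[of "x - real n" 0] by simp
    moreover have "norm (csinc (of_real x - z)) \<le> Cz / (1 + \<bar>x\<bar>)"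
      unfolding Cz_def by (rule norm_csinc_real_shift_le)
    ultimately have "norm (csinc (of_real x - of_nat n) * csinc (of_real x - z)) \<le> 2 / (1 + \<bar>x - real n\<bar>) * (Cz / (1 + \<bar>x\<bar>))"
      unfolding norm_mult by (intro mult_mono) auto
    also have "\<dots> = 2 * Cz * (1 / ((1 + \<bar>x - real n\<bar>) * (1 + \<bar>x\<bar>)))"
      by simp
    also have "\<dots> \<le> 2 * Cz * (((1 + real n) / 2) powr (s - 1) * (?q (x - real n) + ?q x))"
      using s Cz by (intro mult_left_mono powr_split_bound) auto
    finally show ?thesis
      by (simp add: g_def mult_ac)
  qed
  have int: "integrable lborel (\<lambda>x. csinc (of_real x - of_nat n) * csinc (of_real x - z))" for n
    by (rule Bochner_Integration.integrable_bound[OF g[of n]])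
       (use bound[of _ n] in \<open>auto intro!: borel_measurable_continuous_onI continuous_intros intro: order_trans[OF _ abs_ge_self]\<close>)
  show ?thesis
  \<comment> \<open>The 4 is the factor 2 in the kernel bound times two translates of
    \<open>?q\<close> with equal integrals; the power of \<open>1 / 2\<close> comes from halving
    \<open>1 + real n\<close>.\<close>
  proof (rule that[of "4 * Cz * (1 / 2) powr (s - 1) * (\<integral>x. ?q x \<partial>lborel)"])
    fix n
    have "(\<integral>x. norm (csinc (of_real x - of_nat n) * csinc (of_real x - z)) \<partial>lborel) \<le> (\<integral>x. g n x \<partial>lborel)"
      by (intro integral_mono integrable_norm int g bound)
    also have "\<dots> = 4 * Cz * ((1 + real n) * (1 / 2)) powr (s - 1) * (\<integral>x. ?q x \<partial>lborel)"
      unfolding g_def using q qn[of n] by simp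
    also have "\<dots> = 4 * Cz * (1 / 2) powr (s - 1) * (\<integral>x. ?q x \<partial>lborel) * (1 + real n) powr (s - 1)"
      by (subst powr_mult) simp_all
    finally show "(\<integral>x. norm (csinc (of_real x - of_nat n) * csinc (of_real x - z)) \<partial>lborel) \<le> \<dots>" .
  qed (use Cz int in auto)
qed

text \<open>Absolute integrability identifies the limit over symmetric intervals with the Lebesgue
  integral; translation by \<open>real m\<close> reduces the general case to the centred
  one.\<close>

lemma has_bochner_integral_csinc_csinc:
  "has_bochner_integral lborel (\<lambda>x. csinc (of_real x - of_nat m) * csinc (of_real x - z)) (csinc (z - of_nat m))"
proof -
  have int: "integrable lborel (\<lambda>x. csinc (of_real x - of_nat n) * csinc (of_real x - z))" for n z
    by (rule integral_csinc_product_bound[of 1 z]) auto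
  have lim: "(\<integral>x. csinc (of_real x) * csinc (of_real x - z) \<partial>lborel) = csinc z" for z
  proof -
    let ?f = "\<lambda>x. csinc (of_real x) * csinc (of_real x - z)"
    have f: "integrable lborel ?f"
      using int[of 0 z] by simp
    have "(\<lambda>n. \<integral>x. indicator {- real n..real n} x *\<^sub>R ?f x \<partial>lborel) \<longlonglongrightarrow> (\<integral>x. ?f x \<partial>lborel)"
    proof (rule integral_dominated_convergence[where w = "\<lambda>x. norm (?f x)"])
      have "(\<lambda>n. indicator {- real n..real n} x *\<^sub>R ?f x) \<longlonglongrightarrow> ?f x" for x
      proof (rule tendsto_eventually)
        show "eventually (\<lambda>n. indicator {- real n..real n} x *\<^sub>R ?f x = ?f x) sequentially"
          using eventually_ge_at_top[of "nat \<lceil>\<bar>x\<bar>\<rceil>"]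
        proof eventually_elim
          case (elim n)
          then have "\<bar>x\<bar> \<le> real n"
            by linarith
          then show ?case
            by (auto simp: indicator_def)
        qed
      qed
      then show "AE x in lborel. (\<lambda>n. indicator {- real n..real n} x *\<^sub>R ?f x) \<longlonglongrightarrow> ?f x"
        by simp
    qed (use f in \<open>auto intro!: AE_I2 simp: indicator_def\<close>)
    moreover have "(\<integral>x. indicator {- real n..real n} x *\<^sub>R ?f x \<partial>lborel) = integral {- real n..real n} ?f" for n
      using set_borel_integral_eq_integral(2)[of "{- real n..real n}" ?f] integrable_mult_indicator[OF _ f, of "{- real n..real n}"]
      by (simp add: set_lebesgue_integral_def set_integrable_def)
    ultimately show ?thesis
      using tendsto_integral_csinc_csinc[of z] LIMSEQ_unique by auto
  qed
  have "(\<integral>x. csinc (of_real x - of_nat m) * csinc (of_real x - z) \<partial>lborel) =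
      (\<integral>x. csinc (of_real x) * csinc (of_real x - (z - of_nat m)) \<partial>lborel)"
    by (subst lborel_integral_real_affine[of 1 _ "real m"]) (simp_all add: algebra_simps)
  with lim[of "z - of_nat m"] int[of m z] show ?thesis
    by (simp add: has_bochner_integral_iff)
qed

section \<open>Termwise integration of the cardinal series\<close>

text \<open>The summands are of order \<open>n powr (s - 2 - Re w)\<close>, and
  \<open>s < 1 + Re w\<close> puts this exponent below -1.\<close>

lemma summable_gbinomial_powr:
  fixes w :: complex
  assumes "s \<le> 1" "s < 1 + Re w"
  shows "summable (\<lambda>n. norm (w gchoose n) * (1 + real n) powr (s - 1))"
proof -
  obtain K where K: "K > 0"
    "\<And>n. n \<ge> 1 \<Longrightarrow> norm (w gchoose Suc n) * real (Suc n) \<le> K * real n powr (- Re w)"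
    using gbinomial_Suc_bound[of w] by blast
  have "summable (\<lambda>n. K * real n powr (s - 2 - Re w))"
    using assms by (intro summable_mult) (simp add: summable_real_powr_iff)
  moreover have "norm (norm (w gchoose Suc n) * (1 + real (Suc n)) powr (s - 1)) \<le> K * real n powr (s - 2 - Re w)"
    if n: "n \<ge> 1" for n
  proof -
    have "norm (w gchoose Suc n) * real n \<le> norm (w gchoose Suc n) * real (Suc n)"
      by (intro mult_left_mono) auto
    also note K(2)[OF n]
    finally have "norm (w gchoose Suc n) \<le> K * real n powr (- Re w) / real n"
      using n by (simp add: field_simps)
    also have "\<dots> = K * real n powr (- Re w - 1)"
      using n by (subst powr_diff) simp
    finally have "norm (w gchoose Suc n) * (1 + real (Suc n)) powr (s - 1) \<le>
        (K * real n powr (- Re w - 1)) * real n powr (s - 1)"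
      using n assms K(1) by (intro mult_mono powr_mono2') auto
    also have "\<dots> = K * real n powr (s - 2 - Re w)"
      by (simp add: mult.assoc powr_add[symmetric] algebra_simps)
    finally show ?thesis
      by simp
  qed
  ultimately have "summable (\<lambda>n. norm (w gchoose Suc n) * (1 + real (Suc n)) powr (s - 1))"
    by (rule summable_comparison_test'[of _ 1])
  then show ?thesis
    by (subst (asm) summable_Suc_iff)
qed

theorem mainTheorem11:
  fixes w z :: complex
  assumes "Re w > -1"
  shows "has_bochner_integral lborel
           (\<lambda>x::real. cbinomial w (of_real x) * csinc (of_real x - z))
           (cbinomial w z)"
proof -
  \<comment> \<open>Halving keeps \<open>s\<close> positive and strictly below
    \<open>1 + Re w\<close>; the minimum enforces \<open>s \<le> 1\<close>.\<close>
  define s where "s = min 1 ((1 + Re w) / 2)"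
  have s: "0 < s" "s \<le> 1" "s < 1 + Re w"
    using assms by (auto simp: s_def min_def)
  define f where "f n x = (w gchoose n) * (csinc (of_real x - of_nat n) * csinc (of_real x - z))" for n and x :: real
  obtain C where C: "C \<ge> 0"
    "\<And>n. integrable lborel (\<lambda>x. csinc (of_real x - of_nat n) * csinc (of_real x - z))"
    "\<And>n. (\<integral>x. norm (csinc (of_real x - of_nat n) * csinc (of_real x - z)) \<partial>lborel) \<le> C * (1 + real n) powr (s - 1)"
    using integral_csinc_product_bound[OF s(1,2), of z] by blast
  have summ: "summable (\<lambda>n. norm (w gchoose n) * (1 + real n) powr (s - 1))"
    using s by (intro summable_gbinomial_powr)
  have f_int: "integrable lborel (f n)" for n
    unfolding f_def by (intro integrable_mult_right C)
  have f_sums: "(\<lambda>n. f n x) sums (cbinomial w (of_real x) * csinc (of_real x - z))" for x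
    using sums_mult2[OF cbinomial_cardinal_series[OF assms, of "of_real x"], of "csinc (of_real x - z)"]
    by (simp add: f_def mult_ac)
  have norm_summable: "summable (\<lambda>n. norm (f n x))" for x
  proof (rule summable_comparison_test')
    let ?D = "2 * (1 + \<bar>x\<bar>) * norm (csinc (of_real x - z))"
    show "summable (\<lambda>n. ?D * (norm (w gchoose n) * (1 + real n) powr (s - 1)))"
      by (intro summable_mult summ)
    fix n
    \<comment> \<open>By evenness of \<open>csinc\<close> the decay bound is used with
      \<open>real n\<close> as the variable and \<open>x\<close> as the shift, giving decay in
      \<open>n\<close> for fixed \<open>x\<close>.\<close>
    have "norm (csinc (of_real x - of_nat n)) \<le> 2 * (1 + \<bar>x\<bar>) / (1 + real n)"
      using norm_csinc_real_shift_le[of "real n" "of_real x"] csinc_minus[of "of_real x - of_nat n"] by simp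
    also have "\<dots> = 2 * (1 + \<bar>x\<bar>) * (1 + real n) powr (- 1)"
      by (simp add: powr_minus divide_inverse)
    \<comment> \<open>The exponent is weakened to \<open>s - 1\<close> so that \<open>summ\<close>
      also covers the pointwise series.\<close>
    also have "\<dots> \<le> 2 * (1 + \<bar>x\<bar>) * (1 + real n) powr (s - 1)"
      using s by (intro mult_left_mono powr_mono) auto
    finally have "norm (f n x) \<le> norm (w gchoose n) * ((2 * (1 + \<bar>x\<bar>) * (1 + real n) powr (s - 1)) * norm (csinc (of_real x - z)))"
      unfolding f_def norm_mult by (intro mult_left_mono mult_right_mono) auto
    then show "norm (norm (f n x)) \<le> ?D * (norm (w gchoose n) * (1 + real n) powr (s - 1))"
      by (simp add: mult_ac)
  qed
  have int_summable: "summable (\<lambda>n. \<integral>x. norm (f n x) \<partial>lborel)"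
  proof (rule summable_comparison_test')
    show "summable (\<lambda>n. C * (norm (w gchoose n) * (1 + real n) powr (s - 1)))"
      by (intro summable_mult summ)
    fix n
    have "(\<integral>x. norm (f n x) \<partial>lborel) \<le> norm (w gchoose n) * (C * (1 + real n) powr (s - 1))"
      unfolding f_def norm_mult[of "w gchoose n"] using C(3)[of n] by (simp add: mult_left_mono)
    then show "norm (\<integral>x. norm (f n x) \<partial>lborel) \<le> C * (norm (w gchoose n) * (1 + real n) powr (s - 1))"
      by (simp add: mult_ac)
  qed
  have sum_eq: "(\<Sum>n. f n x) = cbinomial w (of_real x) * csinc (of_real x - z)" for x
    using f_sums by (rule sums_unique[symmetric])
  have "integral\<^sup>L lborel (f n) = (w gchoose n) * csinc (z - of_nat n)" for n
    unfolding f_def using has_bochner_integral_csinc_csinc[of n z]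
    by (simp add: has_bochner_integral_iff)
  moreover have "(\<lambda>n. integral\<^sup>L lborel (f n)) sums (\<integral>x. (\<Sum>n. f n x) \<partial>lborel)"
    by (intro sums_integral f_int AE_I2 norm_summable int_summable)
  ultimately have "(\<integral>x. (\<Sum>n. f n x) \<partial>lborel) = cbinomial w z"
    using cbinomial_cardinal_series[OF assms, of z] by (simp add: sums_unique2)
  moreover have "integrable lborel (\<lambda>x. \<Sum>n. f n x)"
    by (intro integrable_suminf f_int AE_I2 norm_summable int_summable)
  ultimately show ?thesis
    by (simp add: has_bochner_integral_iff sum_eq)
qed

end
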